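(* Let $(H,\omega)$ be a dual quasi-bialgebra and let $V$ be a one-dimensional vector space, endowed with linear maps $\rho:V\to H\otimes V$ and $\vartriangleright:H\otimes V\to V$. Then $(V,\rho,\vartriangleright)$ is an object of ${}_H^H\mathcal{YD}$ if and only if there exist $g\in G(H)$ and $\chi\in H^*$ with $\chi(1_H)=1$ such that for all $v\in V$ and $h,l\in H$: (i) $(V,\rho)$ is a left $H$-comodule and $\rho(v)=g\otimes v$; (ii) $h\vartriangleright v=\chi(h)v$ and $$\chi(hl)=\omega^{-1}(h_1\otimes l_1\otimes g)\,\chi(l_2)\,\omega(h_2\otimes g\otimes l_3)\,\chi(h_3)\,\omega^{-1}(g\otimes h_4\otimes l_4);$$ (iii) $g\,\chi(h_1)h_2=h_1\chi(h_2)\,g$.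
   Context: Conventions: $\Bbbk$ is an algebraically closed field of characteristic zero; everything is over $\Bbbk$. $\Delta(h)=h_1\otimes h_2$ (summation omitted), $\ast$ is convolution, $\omega^{-1}$ is the convolution inverse, $G(H)$ is the set of grouplike elements. A coalgebra with multiplication and unit is a coalgebra $H$ with coalgebra maps $m:H\otimes H\to H$, $u:\Bbbk\to H$; $1_H=u(1)$. A dual quasi-bialgebra $(H,\omega)$ is a coalgebra with multiplication and unit together with a convolution invertible $\omega:H^{\otimes 3}\to\Bbbk$ such that $(\varepsilon\otimes\omega)\ast\omega(\mathrm{id}\otimes m\otimes \mathrm{id})\ast(\omega\otimes\varepsilon)=\omega(\mathrm{id}\otimes \mathrm{id}\otimes m)\ast\omega(m\otimes \mathrm{id}\otimes \mathrm{id})$ (3-cocycle), $\omega(h\otimes 1_H\otimes h')=\varepsilon(h)\varepsilon(h')$ (normalized), $h_1(k_1l_1)\,\omega(h_2\otimes k_2\otimes l_2)=\omega(h_1\otimes k_1\otimes l_1)\,(h_2k_2)l_2$ and $1_Hh=h=h1_H$. The category ${}_H^H\mathcal{YD}$ of Yetter-Drinfeld modules: objects are triples $(V,\rho,\vartriangleright)$ with $(V,\rho)$ a left $H$-comodule, $\rho(v)=v_{-1}\otimes v_0$, and $\vartriangleright:H\otimes V\to V$ a linear map such that for all $h,l\in H$, $v\in V$: $(hl)\vartriangleright v=\omega^{-1}(h_1\otimes l_1\otimes v_{-1})\,\omega(h_2\otimes(l_2\vartriangleright v_0)_{-1}\otimes l_3)\,\omega^{-1}((h_3\vartriangleright(l_2\vartriangleright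 v_0)_0)_{-1}\otimes h_4\otimes l_4)\,(h_3\vartriangleright(l_2\vartriangleright v_0)_0)_0$; $1_H\vartriangleright v=v$; and $(h_1\vartriangleright v)_{-1}h_2\otimes(h_1\vartriangleright v)_0=h_1v_{-1}\otimes(h_2\vartriangleright v_0)$. *)

theory Defs
  imports
    "HOL-Computational_Algebra.Polynomial"
    "HOL-Library.Function_Algebras"
begin

section \<open>Multilinear maps\<close>

text \<open>
  A vector space over the field \<open>'k\<close> is a type together with a scalar multiplication, in the sense
  of the locale \<^locale>\<open>vector_space\<close>; the field itself carries the scalar multiplication \<open>(*)\<close>.
  Linear maps out of tensor powers are given as multilinear maps.
\<close>

definition bilinear_map ::
  "('k::field \<Rightarrow> 'a::ab_group_add \<Rightarrow> 'a) \<Rightarrow> ('k \<Rightarrow> 'b::ab_group_add \<Rightarrow> 'b) \<Rightarrow>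
   ('k \<Rightarrow> 'w::ab_group_add \<Rightarrow> 'w) \<Rightarrow> ('a \<Rightarrow> 'b \<Rightarrow> 'w) \<Rightarrow> bool" where
  "bilinear_map sA sB sW f \<longleftrightarrow>
     (\<forall>b. Vector_Spaces.linear sA sW (\<lambda>a. f a b)) \<and>
     (\<forall>a. Vector_Spaces.linear sB sW (\<lambda>b. f a b))"

definition trilinear_map ::
  "('k::field \<Rightarrow> 'a::ab_group_add \<Rightarrow> 'a) \<Rightarrow> ('k \<Rightarrow> 'b::ab_group_add \<Rightarrow> 'b) \<Rightarrow>
   ('k \<Rightarrow> 'c::ab_group_add \<Rightarrow> 'c) \<Rightarrow> ('k \<Rightarrow> 'w::ab_group_add \<Rightarrow> 'w) \<Rightarrow>
   ('a \<Rightarrow> 'b \<Rightarrow> 'c \<Rightarrow> 'w) \<Rightarrow> bool" where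
  "trilinear_map sA sB sC sW f \<longleftrightarrow>
     (\<forall>b c. Vector_Spaces.linear sA sW (\<lambda>a. f a b c)) \<and>
     (\<forall>a c. Vector_Spaces.linear sB sW (\<lambda>b. f a b c)) \<and>
     (\<forall>a b. Vector_Spaces.linear sC sW (\<lambda>c. f a b c))"

definition fun_scale :: "'k::field \<Rightarrow> ('x \<Rightarrow> 'k) \<Rightarrow> 'x \<Rightarrow> 'k" where
  "fun_scale c F = (\<lambda>x. c * F x)"

lemma vector_space_fun_scale: "vector_space fun_scale"
  by unfold_locales (auto simp: fun_scale_def fun_eq_iff algebra_simps)

lemma vector_space_field: "vector_space ((*) :: 'k::field \<Rightarrow> 'k \<Rightarrow> 'k)"
  by unfold_locales (auto simp: algebra_simps)

lemma linear_fun_scale_eval: "Vector_Spaces.linear fun_scale (*) (\<lambda>F. F x)"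
  unfolding linear_iff_module_hom module_hom_def module_hom_axioms_def
  by (auto simp: fun_scale_def module_iff_vector_space vector_space_fun_scale vector_space_field)


section \<open>Tensor products\<close>

text \<open>
  Concrete model of \<open>A \<otimes> B\<close>: the pure tensor \<open>a \<otimes> b\<close> is the functional that evaluates a bilinear
  form \<open>\<beta>\<close> at \<open>(a, b)\<close>, and \<open>A \<otimes> B\<close> is the linear span of the pure tensors. The universal property,
  for arbitrary vector spaces as target, is proved below
  (\<open>bilinear_map_tensor\<close>, \<open>tensor_universal\<close> and \<open>tensor_unique\<close>, and their analogues for three
  factors).
  The triple product is defined directly, so that the two bracketings are identified.
\<close>

definition tensor ::
  "('k::field \<Rightarrow> 'a::ab_group_add \<Rightarrow> 'a) \<Rightarrow> ('k \<Rightarrow> 'b::ab_group_add \<Rightarrow> 'b) \<Rightarrow>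
   'a \<Rightarrow> 'b \<Rightarrow> (('a \<Rightarrow> 'b \<Rightarrow> 'k) \<Rightarrow> 'k)" where
  "tensor sA sB a b = (\<lambda>\<beta>. if bilinear_map sA sB (*) \<beta> then \<beta> a b else 0)"

definition tensor_space ::
  "('k::field \<Rightarrow> 'a::ab_group_add \<Rightarrow> 'a) \<Rightarrow> ('k \<Rightarrow> 'b::ab_group_add \<Rightarrow> 'b) \<Rightarrow>
   (('a \<Rightarrow> 'b \<Rightarrow> 'k) \<Rightarrow> 'k) set" where
  "tensor_space sA sB = module.span fun_scale {tensor sA sB a b | a b. True}"

definition tensor3 ::
  "('k::field \<Rightarrow> 'a::ab_group_add \<Rightarrow> 'a) \<Rightarrow> ('k \<Rightarrow> 'b::ab_group_add \<Rightarrow> 'b) \<Rightarrow>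
   ('k \<Rightarrow> 'c::ab_group_add \<Rightarrow> 'c) \<Rightarrow> 'a \<Rightarrow> 'b \<Rightarrow> 'c \<Rightarrow> (('a \<Rightarrow> 'b \<Rightarrow> 'c \<Rightarrow> 'k) \<Rightarrow> 'k)" where
  "tensor3 sA sB sC a b c = (\<lambda>\<tau>. if trilinear_map sA sB sC (*) \<tau> then \<tau> a b c else 0)"

definition tensor3_space ::
  "('k::field \<Rightarrow> 'a::ab_group_add \<Rightarrow> 'a) \<Rightarrow> ('k \<Rightarrow> 'b::ab_group_add \<Rightarrow> 'b) \<Rightarrow>
   ('k \<Rightarrow> 'c::ab_group_add \<Rightarrow> 'c) \<Rightarrow> (('a \<Rightarrow> 'b \<Rightarrow> 'c \<Rightarrow> 'k) \<Rightarrow> 'k) set" where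
  "tensor3_space sA sB sC = module.span fun_scale {tensor3 sA sB sC a b c | a b c. True}"

lemma linear_fun_scale_iff:
  assumes "vector_space sA"
  shows "Vector_Spaces.linear sA fun_scale f \<longleftrightarrow> (\<forall>x. Vector_Spaces.linear sA (*) (\<lambda>a. f a x))"
  using assms
  unfolding linear_iff_module_hom module_hom_def module_hom_axioms_def
  by (auto simp: fun_scale_def module_iff_vector_space vector_space_fun_scale vector_space_field
      fun_eq_iff)

lemma linear_zero_form: "vector_space sA \<Longrightarrow> Vector_Spaces.linear sA (*) (\<lambda>a. 0)"
  unfolding linear_iff_module_hom module_hom_def module_hom_axioms_def
  by (auto simp: module_iff_vector_space vector_space_field)

lemma bilinear_map_tensor:
  assumes "vector_space sA" "vector_space sB"
  shows "bilinear_map sA sB fun_scale (tensor sA sB)"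
proof -
  have "Vector_Spaces.linear sA (*) (\<lambda>a. tensor sA sB a b \<beta>)" for b \<beta>
    using assms by (cases "bilinear_map sA sB (*) \<beta>")
      (simp add: tensor_def bilinear_map_def, simp add: tensor_def linear_zero_form)
  moreover have "Vector_Spaces.linear sB (*) (\<lambda>b. tensor sA sB a b \<beta>)" for a \<beta>
    using assms by (cases "bilinear_map sA sB (*) \<beta>")
      (simp add: tensor_def bilinear_map_def, simp add: tensor_def linear_zero_form)
  ultimately show ?thesis
    unfolding bilinear_map_def by (simp add: linear_fun_scale_iff assms)
qed

lemma trilinear_map_tensor3:
  assumes "vector_space sA" "vector_space sB" "vector_space sC"
  shows "trilinear_map sA sB sC fun_scale (tensor3 sA sB sC)"
proof -
  have "Vector_Spaces.linear sA (*) (\<lambda>a. tensor3 sA sB sC a b c \<tau>)" for b c \<tau>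
    using assms by (cases "trilinear_map sA sB sC (*) \<tau>")
      (simp add: tensor3_def trilinear_map_def, simp add: tensor3_def linear_zero_form)
  moreover have "Vector_Spaces.linear sB (*) (\<lambda>b. tensor3 sA sB sC a b c \<tau>)" for a c \<tau>
    using assms by (cases "trilinear_map sA sB sC (*) \<tau>")
      (simp add: tensor3_def trilinear_map_def, simp add: tensor3_def linear_zero_form)
  moreover have "Vector_Spaces.linear sC (*) (\<lambda>c. tensor3 sA sB sC a b c \<tau>)" for a b \<tau>
    using assms by (cases "trilinear_map sA sB sC (*) \<tau>")
      (simp add: tensor3_def trilinear_map_def, simp add: tensor3_def linear_zero_form)
  ultimately show ?thesis
    unfolding trilinear_map_def by (simp add: linear_fun_scale_iff assms)
qed

text \<open>
  The common core of the universal properties: \<open>t i\<close> are the pure tensors, \<open>f i\<close> the prescribed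
  values, and every linear form of the \<open>f i\<close> is induced by a linear form on tensors.
\<close>

lemma linear_form_separates:
  assumes "vector_space sW" and "\<And>\<phi>. Vector_Spaces.linear sW (*) \<phi> \<Longrightarrow> \<phi> v = \<phi> w"
  shows "v = w"
proof (rule ccontr)
  interpret W: vector_space sW by fact
  interpret P: vector_space_pair sW "(*)"
    using assms(1) vector_space_field by (simp add: vector_space_pair_def)
  assume "v \<noteq> w"
  then have "W.independent {v - w}" by simp
  from P.linear_independent_extend[OF this, of "\<lambda>_. 1"]
  obtain \<phi> where \<phi>: "Vector_Spaces.linear sW (*) \<phi>" "\<phi> (v - w) = 1" by auto
  have "\<phi> (v - w) = \<phi> v - \<phi> w"
    using \<phi>(1) by (rule P.linear_diff)
  with \<phi> assms(2)[OF \<phi>(1)] show False by simp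
qed

lemma linear_extend_pure:
  fixes t :: "'i \<Rightarrow> 'x \<Rightarrow> 'k::field" and sW :: "'k \<Rightarrow> 'w::ab_group_add \<Rightarrow> 'w"
  assumes W: "vector_space sW"
    and ev: "\<And>\<phi>. Vector_Spaces.linear sW (*) \<phi> \<Longrightarrow>
              \<exists>e. Vector_Spaces.linear fun_scale (*) e \<and> (\<forall>i. e (t i) = \<phi> (f i))"
  shows "\<exists>g. Vector_Spaces.linear fun_scale sW g \<and> (\<forall>i. g (t i) = f i)"
proof -
  interpret T: vector_space "fun_scale :: 'k \<Rightarrow> ('x \<Rightarrow> 'k) \<Rightarrow> 'x \<Rightarrow> 'k"
    by (rule vector_space_fun_scale)
  interpret P: vector_space_pair "fun_scale :: 'k \<Rightarrow> ('x \<Rightarrow> 'k) \<Rightarrow> 'x \<Rightarrow> 'k" sW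
    using W vector_space_fun_scale by (simp add: vector_space_pair_def)
  interpret Q: vector_space_pair "fun_scale :: 'k \<Rightarrow> ('x \<Rightarrow> 'k) \<Rightarrow> 'x \<Rightarrow> 'k"
    "(*) :: 'k \<Rightarrow> 'k \<Rightarrow> 'k"
    using vector_space_field vector_space_fun_scale by (simp add: vector_space_pair_def)
  obtain C where C: "C \<subseteq> range t" "T.independent C" "range t \<subseteq> T.span C"
    using T.maximal_independent_subset[of "range t"] by blast
  define pre where "pre c = (SOME i. t i = c)" for c
  have pre: "t (pre c) = c" if "c \<in> C" for c
  proof -
    from C(1) that obtain i where "t i = c" by blast
    then show ?thesis unfolding pre_def by (rule someI)
  qed
  obtain g where g: "Vector_Spaces.linear fun_scale sW g" "\<And>c. c \<in> C \<Longrightarrow> g c = f (pre c)"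
    using P.linear_independent_extend[OF C(2), of "\<lambda>c. f (pre c)"] by blast
  have "g (t i) = f i" for i
  proof (rule linear_form_separates[OF W])
    fix \<phi> assume \<phi>: "Vector_Spaces.linear sW (*) \<phi>"
    obtain e where e: "Vector_Spaces.linear fun_scale (*) e" "\<And>i. e (t i) = \<phi> (f i)"
      using ev[OF \<phi>] by blast
    have "(\<phi> \<circ> g) (t i) = e (t i)"
    proof (rule Q.linear_eq_on[of "\<phi> \<circ> g" e "t i" C])
      show "Vector_Spaces.linear fun_scale (*) (\<phi> \<circ> g)"
        using g(1) \<phi> by (rule Vector_Spaces.linear_compose)
      show "t i \<in> T.span C" using C(3) by auto
      show "(\<phi> \<circ> g) c = e c" if "c \<in> C" for c
        using that g(2)[OF that] e(2)[of "pre c"] pre[OF that] by simp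
    qed (rule e(1))
    then show "\<phi> (g (t i)) = \<phi> (f i)" by (simp add: e(2))
  qed
  with g(1) show ?thesis by blast
qed

lemma tensor_universal:
  fixes sA :: "'k::field \<Rightarrow> 'a::ab_group_add \<Rightarrow> 'a" and sB :: "'k \<Rightarrow> 'b::ab_group_add \<Rightarrow> 'b"
    and sW :: "'k \<Rightarrow> 'w::ab_group_add \<Rightarrow> 'w"
  assumes f: "bilinear_map sA sB sW f"
  shows "\<exists>g. Vector_Spaces.linear fun_scale sW g \<and> (\<forall>a b. g (tensor sA sB a b) = f a b)"
proof -
  have W: "vector_space sW"
    using f unfolding bilinear_map_def by (blast dest: Vector_Spaces.linear.axioms(2))
  have "\<exists>g. Vector_Spaces.linear fun_scale sW g \<and>
          (\<forall>i. g (tensor sA sB (fst i) (snd i)) = f (fst i) (snd i))"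
  proof (rule linear_extend_pure[OF W])
    fix \<phi> assume \<phi>: "Vector_Spaces.linear sW (*) \<phi>"
    have "bilinear_map sA sB (*) (\<lambda>a b. \<phi> (f a b))"
      using f \<phi> unfolding bilinear_map_def
      by (auto intro!: Vector_Spaces.linear_compose[of _ sW _ _ \<phi>, unfolded o_def])
    then show "\<exists>e. Vector_Spaces.linear fun_scale (*) e \<and>
          (\<forall>i. e (tensor sA sB (fst i) (snd i)) = \<phi> (f (fst i) (snd i)))"
      by (intro exI[of _ "\<lambda>F. F (\<lambda>a b. \<phi> (f a b))"]) (auto simp: linear_fun_scale_eval tensor_def)
  qed
  then show ?thesis by fastforce
qed

lemma tensor_unique:
  assumes "Vector_Spaces.linear fun_scale sW g" "Vector_Spaces.linear fun_scale sW g'"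
    and "\<And>a b. g (tensor sA sB a b) = g' (tensor sA sB a b)" and "t \<in> tensor_space sA sB"
  shows "g t = g' t"
  by (rule vector_space_pair.linear_eq_on[OF
        vector_space_pair.intro[OF Vector_Spaces.linear.axioms(1,2)[OF assms(1)]]
        assms(1,2) assms(4)[unfolded tensor_space_def]])
     (use assms(3) in blast)

lemma tensor3_universal:
  fixes sA :: "'k::field \<Rightarrow> 'a::ab_group_add \<Rightarrow> 'a" and sB :: "'k \<Rightarrow> 'b::ab_group_add \<Rightarrow> 'b"
    and sC :: "'k \<Rightarrow> 'c::ab_group_add \<Rightarrow> 'c" and sW :: "'k \<Rightarrow> 'w::ab_group_add \<Rightarrow> 'w"
  assumes f: "trilinear_map sA sB sC sW f"
  shows "\<exists>g. Vector_Spaces.linear fun_scale sW g \<and>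
           (\<forall>a b c. g (tensor3 sA sB sC a b c) = f a b c)"
proof -
  have W: "vector_space sW"
    using f unfolding trilinear_map_def by (blast dest: Vector_Spaces.linear.axioms(2))
  have "\<exists>g. Vector_Spaces.linear fun_scale sW g \<and>
          (\<forall>i. g (tensor3 sA sB sC (fst i) (fst (snd i)) (snd (snd i))) =
               f (fst i) (fst (snd i)) (snd (snd i)))"
  proof (rule linear_extend_pure[OF W])
    fix \<phi> assume \<phi>: "Vector_Spaces.linear sW (*) \<phi>"
    have "trilinear_map sA sB sC (*) (\<lambda>a b c. \<phi> (f a b c))"
      using f \<phi> unfolding trilinear_map_def
      by (auto intro!: Vector_Spaces.linear_compose[of _ sW _ _ \<phi>, unfolded o_def])
    then show "\<exists>e. Vector_Spaces.linear fun_scale (*) e \<and>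
          (\<forall>i. e (tensor3 sA sB sC (fst i) (fst (snd i)) (snd (snd i))) =
               \<phi> (f (fst i) (fst (snd i)) (snd (snd i))))"
      by (intro exI[of _ "\<lambda>F. F (\<lambda>a b c. \<phi> (f a b c))"])
         (auto simp: linear_fun_scale_eval tensor3_def)
  qed
  then show ?thesis by fastforce
qed

lemma tensor3_unique:
  assumes "Vector_Spaces.linear fun_scale sW g" "Vector_Spaces.linear fun_scale sW g'"
    and "\<And>a b c. g (tensor3 sA sB sC a b c) = g' (tensor3 sA sB sC a b c)"
    and "t \<in> tensor3_space sA sB sC"
  shows "g t = g' t"
  by (rule vector_space_pair.linear_eq_on[OF
        vector_space_pair.intro[OF Vector_Spaces.linear.axioms(1,2)[OF assms(1)]]
        assms(1,2) assms(4)[unfolded tensor3_space_def]])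
     (use assms(3) in blast)

text \<open>
  The linear map \<open>A \<otimes> B \<rightarrow> W\<close> induced by a bilinear map \<open>f\<close>. Its values off \<^const>\<open>tensor_space\<close>
  depend on a choice and are never used.
\<close>

definition tensor_lift ::
  "('k::field \<Rightarrow> 'a::ab_group_add \<Rightarrow> 'a) \<Rightarrow> ('k \<Rightarrow> 'b::ab_group_add \<Rightarrow> 'b) \<Rightarrow>
   ('k \<Rightarrow> 'w::ab_group_add \<Rightarrow> 'w) \<Rightarrow> ('a \<Rightarrow> 'b \<Rightarrow> 'w) \<Rightarrow> (('a \<Rightarrow> 'b \<Rightarrow> 'k) \<Rightarrow> 'k) \<Rightarrow> 'w" where
  "tensor_lift sA sB sW f =
     (SOME g. Vector_Spaces.linear fun_scale sW g \<and> (\<forall>a b. g (tensor sA sB a b) = f a b))"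

lemma tensor_lift:
  assumes "bilinear_map sA sB sW f"
  shows linear_tensor_lift: "Vector_Spaces.linear fun_scale sW (tensor_lift sA sB sW f)"
    and tensor_lift_tensor: "tensor_lift sA sB sW f (tensor sA sB a b) = f a b"
  using someI_ex[OF tensor_universal[OF assms]] by (auto simp: tensor_lift_def)


section \<open>Sweedler notation\<close>

text \<open>
  \<open>sweedler sA sB sW \<rho> x (\<lambda>a b. f a b)\<close> is the element written \<open>f(x\<^sub>1, x\<^sub>2)\<close> (summation omitted)
  for \<open>\<rho>(x) = x\<^sub>1 \<otimes> x\<^sub>2\<close>, where \<open>f\<close> is bilinear with values in \<open>W\<close>. It serves both comultiplications
  and coactions. Iterated comultiplications are taken on the right-hand tensor factor, which is
  immaterial by coassociativity.
\<close>

definition sweedler ::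
  "('k::field \<Rightarrow> 'a::ab_group_add \<Rightarrow> 'a) \<Rightarrow> ('k \<Rightarrow> 'b::ab_group_add \<Rightarrow> 'b) \<Rightarrow>
   ('k \<Rightarrow> 'w::ab_group_add \<Rightarrow> 'w) \<Rightarrow> ('x \<Rightarrow> (('a \<Rightarrow> 'b \<Rightarrow> 'k) \<Rightarrow> 'k)) \<Rightarrow> 'x \<Rightarrow>
   ('a \<Rightarrow> 'b \<Rightarrow> 'w) \<Rightarrow> 'w" where
  "sweedler sA sB sW \<rho> x f = tensor_lift sA sB sW f (\<rho> x)"

definition sweedler2 ::
  "('k::field \<Rightarrow> 'h::ab_group_add \<Rightarrow> 'h) \<Rightarrow> ('h \<Rightarrow> (('h \<Rightarrow> 'h \<Rightarrow> 'k) \<Rightarrow> 'k)) \<Rightarrow>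
   ('k \<Rightarrow> 'w::ab_group_add \<Rightarrow> 'w) \<Rightarrow> 'h \<Rightarrow> ('h \<Rightarrow> 'h \<Rightarrow> 'w) \<Rightarrow> 'w" where
  "sweedler2 sH \<Delta> sW h f = sweedler sH sH sW \<Delta> h f"

definition sweedler4 ::
  "('k::field \<Rightarrow> 'h::ab_group_add \<Rightarrow> 'h) \<Rightarrow> ('h \<Rightarrow> (('h \<Rightarrow> 'h \<Rightarrow> 'k) \<Rightarrow> 'k)) \<Rightarrow>
   ('k \<Rightarrow> 'w::ab_group_add \<Rightarrow> 'w) \<Rightarrow> 'h \<Rightarrow> ('h \<Rightarrow> 'h \<Rightarrow> 'h \<Rightarrow> 'h \<Rightarrow> 'w) \<Rightarrow> 'w" where
  "sweedler4 sH \<Delta> sW h f =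
     sweedler2 sH \<Delta> sW h (\<lambda>h\<^sub>1 x. sweedler2 sH \<Delta> sW x (\<lambda>h\<^sub>2 y. sweedler2 sH \<Delta> sW y (\<lambda>h\<^sub>3 h\<^sub>4.
       f h\<^sub>1 h\<^sub>2 h\<^sub>3 h\<^sub>4)))"


section \<open>Coalgebras and comodules\<close>

locale coalgebra = vector_space sH
  for sH :: "'k::field \<Rightarrow> 'h::ab_group_add \<Rightarrow> 'h"
    and \<Delta> :: "'h \<Rightarrow> (('h \<Rightarrow> 'h \<Rightarrow> 'k) \<Rightarrow> 'k)"
    and \<epsilon> :: "'h \<Rightarrow> 'k" +
  assumes comult_linear: "Vector_Spaces.linear sH fun_scale \<Delta>"
    and comult_in: "\<Delta> h \<in> tensor_space sH sH"
    and counit_linear: "Vector_Spaces.linear sH (*) \<epsilon>"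
    and coassoc:
      "sweedler2 sH \<Delta> fun_scale h (\<lambda>x h\<^sub>3. sweedler2 sH \<Delta> fun_scale x (\<lambda>h\<^sub>1 h\<^sub>2. tensor3 sH sH sH h\<^sub>1 h\<^sub>2 h\<^sub>3)) =
       sweedler2 sH \<Delta> fun_scale h (\<lambda>h\<^sub>1 x. sweedler2 sH \<Delta> fun_scale x (\<lambda>h\<^sub>2 h\<^sub>3. tensor3 sH sH sH h\<^sub>1 h\<^sub>2 h\<^sub>3))"
    and counit_left: "sweedler2 sH \<Delta> sH h (\<lambda>h\<^sub>1 h\<^sub>2. sH (\<epsilon> h\<^sub>1) h\<^sub>2) = h"
    and counit_right: "sweedler2 sH \<Delta> sH h (\<lambda>h\<^sub>1 h\<^sub>2. sH (\<epsilon> h\<^sub>2) h\<^sub>1) = h"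

definition grouplike ::
  "('k::field \<Rightarrow> 'h::ab_group_add \<Rightarrow> 'h) \<Rightarrow> ('h \<Rightarrow> (('h \<Rightarrow> 'h \<Rightarrow> 'k) \<Rightarrow> 'k)) \<Rightarrow> ('h \<Rightarrow> 'k) \<Rightarrow> 'h set"
  where "grouplike sH \<Delta> \<epsilon> = {g. \<Delta> g = tensor sH sH g g \<and> \<epsilon> g = 1}"

locale left_comodule = coalgebra sH \<Delta> \<epsilon> + V: vector_space sV
  for sH :: "'k::field \<Rightarrow> 'h::ab_group_add \<Rightarrow> 'h"
    and \<Delta> :: "'h \<Rightarrow> (('h \<Rightarrow> 'h \<Rightarrow> 'k) \<Rightarrow> 'k)"
    and \<epsilon> :: "'h \<Rightarrow> 'k"
    and sV :: "'k \<Rightarrow> 'v::ab_group_add \<Rightarrow> 'v"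
    and \<rho> :: "'v \<Rightarrow> (('h \<Rightarrow> 'v \<Rightarrow> 'k) \<Rightarrow> 'k)" +
  assumes coact_linear: "Vector_Spaces.linear sV fun_scale \<rho>"
    and coact_in: "\<rho> v \<in> tensor_space sH sV"
    and coact_coassoc:
      "sweedler sH sV fun_scale \<rho> v (\<lambda>x v\<^sub>0. sweedler2 sH \<Delta> fun_scale x (\<lambda>h\<^sub>1 h\<^sub>2. tensor3 sH sH sV h\<^sub>1 h\<^sub>2 v\<^sub>0)) =
       sweedler sH sV fun_scale \<rho> v (\<lambda>h\<^sub>1 w. sweedler sH sV fun_scale \<rho> w (\<lambda>h\<^sub>2 v\<^sub>0. tensor3 sH sH sV h\<^sub>1 h\<^sub>2 v\<^sub>0))"
    and coact_counit: "sweedler sH sV sV \<rho> v (\<lambda>h v\<^sub>0. sV (\<epsilon> h) v\<^sub>0) = v"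


section \<open>Convolution of linear forms on tensor powers of a coalgebra\<close>

definition conv3 ::
  "('k::field \<Rightarrow> 'h::ab_group_add \<Rightarrow> 'h) \<Rightarrow> ('h \<Rightarrow> (('h \<Rightarrow> 'h \<Rightarrow> 'k) \<Rightarrow> 'k)) \<Rightarrow>
   ('h \<Rightarrow> 'h \<Rightarrow> 'h \<Rightarrow> 'k) \<Rightarrow> ('h \<Rightarrow> 'h \<Rightarrow> 'h \<Rightarrow> 'k) \<Rightarrow> 'h \<Rightarrow> 'h \<Rightarrow> 'h \<Rightarrow> 'k" where
  "conv3 sH \<Delta> \<phi> \<psi> = (\<lambda>a b c.
     sweedler2 sH \<Delta> (*) a (\<lambda>a\<^sub>1 a\<^sub>2. sweedler2 sH \<Delta> (*) b (\<lambda>b\<^sub>1 b\<^sub>2. sweedler2 sH \<Delta> (*) c (\<lambda>c\<^sub>1 c\<^sub>2.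
       \<phi> a\<^sub>1 b\<^sub>1 c\<^sub>1 * \<psi> a\<^sub>2 b\<^sub>2 c\<^sub>2))))"

definition conv4 ::
  "('k::field \<Rightarrow> 'h::ab_group_add \<Rightarrow> 'h) \<Rightarrow> ('h \<Rightarrow> (('h \<Rightarrow> 'h \<Rightarrow> 'k) \<Rightarrow> 'k)) \<Rightarrow>
   ('h \<Rightarrow> 'h \<Rightarrow> 'h \<Rightarrow> 'h \<Rightarrow> 'k) \<Rightarrow> ('h \<Rightarrow> 'h \<Rightarrow> 'h \<Rightarrow> 'h \<Rightarrow> 'k) \<Rightarrow> 'h \<Rightarrow> 'h \<Rightarrow> 'h \<Rightarrow> 'h \<Rightarrow> 'k" where
  "conv4 sH \<Delta> \<phi> \<psi> = (\<lambda>a b c d.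
     sweedler2 sH \<Delta> (*) a (\<lambda>a\<^sub>1 a\<^sub>2. sweedler2 sH \<Delta> (*) b (\<lambda>b\<^sub>1 b\<^sub>2.
     sweedler2 sH \<Delta> (*) c (\<lambda>c\<^sub>1 c\<^sub>2. sweedler2 sH \<Delta> (*) d (\<lambda>d\<^sub>1 d\<^sub>2.
       \<phi> a\<^sub>1 b\<^sub>1 c\<^sub>1 d\<^sub>1 * \<psi> a\<^sub>2 b\<^sub>2 c\<^sub>2 d\<^sub>2)))))"

definition is_conv_inverse3 ::
  "('k::field \<Rightarrow> 'h::ab_group_add \<Rightarrow> 'h) \<Rightarrow> ('h \<Rightarrow> (('h \<Rightarrow> 'h \<Rightarrow> 'k) \<Rightarrow> 'k)) \<Rightarrow> ('h \<Rightarrow> 'k) \<Rightarrow>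
   ('h \<Rightarrow> 'h \<Rightarrow> 'h \<Rightarrow> 'k) \<Rightarrow> ('h \<Rightarrow> 'h \<Rightarrow> 'h \<Rightarrow> 'k) \<Rightarrow> bool" where
  "is_conv_inverse3 sH \<Delta> \<epsilon> \<omega> \<omega>' \<longleftrightarrow>
     trilinear_map sH sH sH (*) \<omega>' \<and>
     conv3 sH \<Delta> \<omega> \<omega>' = (\<lambda>a b c. \<epsilon> a * \<epsilon> b * \<epsilon> c) \<and>
     conv3 sH \<Delta> \<omega>' \<omega> = (\<lambda>a b c. \<epsilon> a * \<epsilon> b * \<epsilon> c)"

text \<open>
  The choice is harmless: two-sided inverses in the convolution algebra are unique.
\<close>

definition conv_inverse3 ::
  "('k::field \<Rightarrow> 'h::ab_group_add \<Rightarrow> 'h) \<Rightarrow> ('h \<Rightarrow> (('h \<Rightarrow> 'h \<Rightarrow> 'k) \<Rightarrow> 'k)) \<Rightarrow> ('h \<Rightarrow> 'k) \<Rightarrow>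
   ('h \<Rightarrow> 'h \<Rightarrow> 'h \<Rightarrow> 'k) \<Rightarrow> 'h \<Rightarrow> 'h \<Rightarrow> 'h \<Rightarrow> 'k" where
  "conv_inverse3 sH \<Delta> \<epsilon> \<omega> = (SOME \<omega>'. is_conv_inverse3 sH \<Delta> \<epsilon> \<omega> \<omega>')"


section \<open>Dual quasi-bialgebras and Yetter-Drinfeld modules\<close>

text \<open>
  \<open>mult_comult\<close>, \<open>mult_counit\<close> say that the multiplication is a coalgebra map for the tensor
  product coalgebra \<open>H \<otimes> H\<close>; \<open>unit_comult\<close>, \<open>unit_counit\<close> say the same of the unit for the
  coalgebra \<open>'k\<close>, whose comultiplication is \<open>c \<mapsto> c \<otimes> 1\<close> and whose counit is the identity.
\<close>

locale coalgebra_mult_unit = coalgebra sH \<Delta> \<epsilon>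
  for sH :: "'k::field \<Rightarrow> 'h::ab_group_add \<Rightarrow> 'h"
    and \<Delta> :: "'h \<Rightarrow> (('h \<Rightarrow> 'h \<Rightarrow> 'k) \<Rightarrow> 'k)"
    and \<epsilon> :: "'h \<Rightarrow> 'k"
    and m :: "'h \<Rightarrow> 'h \<Rightarrow> 'h"
    and u :: "'k \<Rightarrow> 'h" +
  assumes mult_bilinear: "bilinear_map sH sH sH m"
    and mult_comult:
      "\<Delta> (m a b) = sweedler2 sH \<Delta> fun_scale a (\<lambda>a\<^sub>1 a\<^sub>2. sweedler2 sH \<Delta> fun_scale b (\<lambda>b\<^sub>1 b\<^sub>2.
         tensor sH sH (m a\<^sub>1 b\<^sub>1) (m a\<^sub>2 b\<^sub>2)))"
    and mult_counit: "\<epsilon> (m a b) = \<epsilon> a * \<epsilon> b"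
    and unit_linear: "Vector_Spaces.linear (*) sH u"
    and unit_comult: "\<Delta> (u c) = tensor sH sH (u c) (u 1)"
    and unit_counit: "\<epsilon> (u c) = c"

locale dual_quasi_bialgebra = coalgebra_mult_unit sH \<Delta> \<epsilon> m u
  for sH :: "'k::field \<Rightarrow> 'h::ab_group_add \<Rightarrow> 'h"
    and \<Delta> :: "'h \<Rightarrow> (('h \<Rightarrow> 'h \<Rightarrow> 'k) \<Rightarrow> 'k)"
    and \<epsilon> :: "'h \<Rightarrow> 'k"
    and m :: "'h \<Rightarrow> 'h \<Rightarrow> 'h"
    and u :: "'k \<Rightarrow> 'h"
    and \<omega> :: "'h \<Rightarrow> 'h \<Rightarrow> 'h \<Rightarrow> 'k" +
  assumes reassociator_trilinear: "trilinear_map sH sH sH (*) \<omega>"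
    and reassociator_invertible: "\<exists>\<omega>'. is_conv_inverse3 sH \<Delta> \<epsilon> \<omega> \<omega>'"
    and cocycle:
      "conv4 sH \<Delta> (conv4 sH \<Delta> (\<lambda>a b c d. \<epsilon> a * \<omega> b c d) (\<lambda>a b c d. \<omega> a (m b c) d))
         (\<lambda>a b c d. \<omega> a b c * \<epsilon> d) =
       conv4 sH \<Delta> (\<lambda>a b c d. \<omega> a b (m c d)) (\<lambda>a b c d. \<omega> (m a b) c d)"
    and normalized: "\<omega> h (u 1) h' = \<epsilon> h * \<epsilon> h'"
    and quasi_assoc:
      "sweedler2 sH \<Delta> sH h (\<lambda>h\<^sub>1 h\<^sub>2. sweedler2 sH \<Delta> sH k (\<lambda>k\<^sub>1 k\<^sub>2. sweedler2 sH \<Delta> sH l (\<lambda>l\<^sub>1 l\<^sub>2.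
         sH (\<omega> h\<^sub>2 k\<^sub>2 l\<^sub>2) (m h\<^sub>1 (m k\<^sub>1 l\<^sub>1))))) =
       sweedler2 sH \<Delta> sH h (\<lambda>h\<^sub>1 h\<^sub>2. sweedler2 sH \<Delta> sH k (\<lambda>k\<^sub>1 k\<^sub>2. sweedler2 sH \<Delta> sH l (\<lambda>l\<^sub>1 l\<^sub>2.
         sH (\<omega> h\<^sub>1 k\<^sub>1 l\<^sub>1) (m (m h\<^sub>2 k\<^sub>2) l\<^sub>2))))"
    and unit_left: "m (u 1) h = h"
    and unit_right: "m h (u 1) = h"

text \<open>
  In \<open>act_mult\<close>, \<open>a \<otimes> w\<close> stands for \<open>\<rho> (l\<^sub>2 \<rhd> v\<^sub>0)\<close> and \<open>b \<otimes> x\<close> for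
  \<open>\<rho> (h\<^sub>3 \<rhd> (l\<^sub>2 \<rhd> v\<^sub>0)\<^sub>0)\<close>.
\<close>

locale yetter_drinfeld_module =
  dual_quasi_bialgebra sH \<Delta> \<epsilon> m u \<omega> + left_comodule sH \<Delta> \<epsilon> sV \<rho>
  for sH :: "'k::field \<Rightarrow> 'h::ab_group_add \<Rightarrow> 'h"
    and \<Delta> :: "'h \<Rightarrow> (('h \<Rightarrow> 'h \<Rightarrow> 'k) \<Rightarrow> 'k)"
    and \<epsilon> :: "'h \<Rightarrow> 'k"
    and m :: "'h \<Rightarrow> 'h \<Rightarrow> 'h"
    and u :: "'k \<Rightarrow> 'h"
    and \<omega> :: "'h \<Rightarrow> 'h \<Rightarrow> 'h \<Rightarrow> 'k"
    and sV :: "'k \<Rightarrow> 'v::ab_group_add \<Rightarrow> 'v"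
    and \<rho> :: "'v \<Rightarrow> (('h \<Rightarrow> 'v \<Rightarrow> 'k) \<Rightarrow> 'k)"
    and act :: "'h \<Rightarrow> 'v \<Rightarrow> 'v" +
  assumes act_bilinear: "bilinear_map sH sV sV act"
    and act_mult:
      "act (m h l) v =
         sweedler4 sH \<Delta> sV h (\<lambda>h\<^sub>1 h\<^sub>2 h\<^sub>3 h\<^sub>4. sweedler4 sH \<Delta> sV l (\<lambda>l\<^sub>1 l\<^sub>2 l\<^sub>3 l\<^sub>4.
           sweedler sH sV sV \<rho> v (\<lambda>v' v\<^sub>0.
           sweedler sH sV sV \<rho> (act l\<^sub>2 v\<^sub>0) (\<lambda>a w.
           sweedler sH sV sV \<rho> (act h\<^sub>3 w) (\<lambda>b x.
             sV (conv_inverse3 sH \<Delta> \<epsilon> \<omega> h\<^sub>1 l\<^sub>1 v' * \<omega> h\<^sub>2 a l\<^sub>3 * conv_inverse3 sH \<Delta> \<epsilon> \<omega> b h\<^sub>4 l\<^sub>4) x)))))"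
    and act_unit: "act (u 1) v = v"
    and act_coact:
      "sweedler2 sH \<Delta> fun_scale h (\<lambda>h\<^sub>1 h\<^sub>2. sweedler sH sV fun_scale \<rho> (act h\<^sub>1 v) (\<lambda>a w.
         tensor sH sV (m a h\<^sub>2) w)) =
       sweedler2 sH \<Delta> fun_scale h (\<lambda>h\<^sub>1 h\<^sub>2. sweedler sH sV fun_scale \<rho> v (\<lambda>v' v\<^sub>0.
         tensor sH sV (m h\<^sub>1 v') (act h\<^sub>2 v\<^sub>0)))"

end

theory Submission
  imports Defs
begin

text \<open>
  Tensoring with a one-dimensional space \<open>V = \<langle>e\<rangle>\<close> loses nothing: every element of \<open>H \<otimes> V\<close> is
  \<open>g \<otimes> e\<close> for exactly one \<open>g\<close>, and every endomorphism of \<open>V\<close> is a scalar. Hence a coaction on \<open>V\<close>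
  is \<open>v \<mapsto> g \<otimes> v\<close> for one element \<open>g\<close>, and an action is \<open>h \<rhd> v = \<chi>(h) v\<close> for one linear form
  \<open>\<chi>\<close>. Cancelling the last tensor factor \<open>e\<close> in the comodule axioms shows that \<open>g\<close> is grouplike
  (\<open>grouplike_of_comodule\<close>).

  In the Yetter-Drinfeld axioms every leg in \<open>H\<close> of a coaction becomes \<open>g\<close> and every action becomes a
  scalar. Both sides of the multiplicativity axiom are then of the form \<open>c \<cdot> v\<close> with \<open>c\<close> in the field,
  and both sides of the compatibility axiom are of the form \<open>x \<otimes> v\<close> with \<open>x\<close> in \<open>H\<close>. Cancelling \<open>v\<close>
  leaves an identity of scalars and one of elements of \<open>H\<close>, and at \<open>v = e\<close> the cancellation is an
  equivalence (\<open>act_mult_iff\<close>, \<open>act_coact_iff\<close>).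

  What needs care is that a Sweedler expression has its intended value only for a multilinear
  integrand. Pulling \<open>v\<close> out of nested expressions amounts to exchanging them with the linear maps
  \<open>c \<mapsto> c \<cdot> v\<close> and \<open>x \<mapsto> x \<otimes> v\<close>, which in turn requires that each inner expression depends linearly
  on the legs of the outer ones (\<open>linear_sweedler_parameter\<close>, \<open>linear_image_sweedler\<close>).
\<close>

section \<open>Linearity of Sweedler expressions\<close>

lemma bilinear_mapI:
  assumes "\<And>b. Vector_Spaces.linear sA sW (\<lambda>a. f a b)"
    and "\<And>a. Vector_Spaces.linear sB sW (\<lambda>b. f a b)"
  shows "bilinear_map sA sB sW f"
  using assms by (simp add: bilinear_map_def)

lemma linear_mapD:
  assumes "Vector_Spaces.linear s s' f"
  shows "f (x + y) = f x + f y" and "f (s c x) = s' c (f x)"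
  using assms by (simp_all add: Vector_Spaces.linear_iff)

text \<open>
  Both sides are linear in the tensor \<open>\<rho> x\<close> and agree on pure tensors. Off the span of the
  pure tensors the two lifts are independent choices, whence the hypothesis on \<open>\<rho> x\<close>.
\<close>

lemma linear_image_sweedler:
  assumes x: "\<rho> x \<in> tensor_space sA sB" and f: "bilinear_map sA sB sW f"
    and L: "Vector_Spaces.linear sW sW' L"
  shows "L (sweedler sA sB sW \<rho> x f) = sweedler sA sB sW' \<rho> x (\<lambda>a b. L (f a b))"
proof -
  have Lf: "bilinear_map sA sB sW' (\<lambda>a b. L (f a b))"
    using f L by (simp add: bilinear_map_def Vector_Spaces.linear_iff)
  have "(L \<circ> tensor_lift sA sB sW f) (\<rho> x) = tensor_lift sA sB sW' (\<lambda>a b. L (f a b)) (\<rho> x)"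
  proof (rule tensor_unique[OF _ _ _ x])
    show "Vector_Spaces.linear fun_scale sW' (L \<circ> tensor_lift sA sB sW f)"
      using linear_tensor_lift[OF f] L by (rule Vector_Spaces.linear_compose)
    show "Vector_Spaces.linear fun_scale sW' (tensor_lift sA sB sW' (\<lambda>a b. L (f a b)))"
      by (rule linear_tensor_lift[OF Lf])
  qed (simp add: tensor_lift_tensor[OF f] tensor_lift_tensor[OF Lf])
  then show ?thesis by (simp add: sweedler_def)
qed

lemma linear_sweedler_argument:
  assumes "Vector_Spaces.linear sX fun_scale \<rho>" and "bilinear_map sA sB sW f"
  shows "Vector_Spaces.linear sX sW (\<lambda>x. sweedler sA sB sW \<rho> x f)"
  using assms(1) linear_tensor_lift[OF assms(2)] by (simp add: sweedler_def Vector_Spaces.linear_iff)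

text \<open>
  The integrand of an inner Sweedler expression depends on the legs of the outer ones; this lemma
  makes the inner expression an admissible integrand of the outer one.
\<close>

lemma linear_sweedler_parameter:
  assumes x: "\<rho> x \<in> tensor_space sA sB" and f: "\<And>p. bilinear_map sA sB sW (f p)"
    and lin: "\<And>a b. Vector_Spaces.linear sP sW (\<lambda>p. f p a b)"
  shows "Vector_Spaces.linear sP sW (\<lambda>p. sweedler sA sB sW \<rho> x (f p))"
proof -
  have P: "vector_space sP" and W: "vector_space sW"
    using lin[of undefined undefined] by (simp_all add: Vector_Spaces.linear_iff)
  interpret T: vector_space_pair fun_scale sW
    using W vector_space_fun_scale by (simp add: vector_space_pair_def)
  have "tensor_lift sA sB sW (f (p + q)) (\<rho> x) =
      tensor_lift sA sB sW (f p) (\<rho> x) + tensor_lift sA sB sW (f q) (\<rho> x)" for p q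
    by (rule tensor_unique[OF linear_tensor_lift[OF f]
          T.linear_compose_add[OF linear_tensor_lift[OF f] linear_tensor_lift[OF f]] _ x])
       (use lin in \<open>simp add: tensor_lift_tensor[OF f] Vector_Spaces.linear_iff\<close>)
  moreover have "tensor_lift sA sB sW (f (sP c p)) (\<rho> x) =
      sW c (tensor_lift sA sB sW (f p) (\<rho> x))" for c p
    by (rule tensor_unique[OF linear_tensor_lift[OF f]
          T.linear_compose_scale_right[OF linear_tensor_lift[OF f]] _ x])
       (use lin in \<open>simp add: tensor_lift_tensor[OF f] Vector_Spaces.linear_iff\<close>)
  ultimately show ?thesis using P W by (simp add: Vector_Spaces.linear_iff sweedler_def)
qed

lemma sweedler_pure:
  assumes "\<rho> x = tensor sA sB a b" and "bilinear_map sA sB sW f"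
  shows "sweedler sA sB sW \<rho> x f = f a b"
  by (simp add: sweedler_def assms(1) tensor_lift_tensor[OF assms(2)])

definition quadrilinear_map ::
  "('k::field \<Rightarrow> 'h::ab_group_add \<Rightarrow> 'h) \<Rightarrow> ('k \<Rightarrow> 'w::ab_group_add \<Rightarrow> 'w) \<Rightarrow>
   ('h \<Rightarrow> 'h \<Rightarrow> 'h \<Rightarrow> 'h \<Rightarrow> 'w) \<Rightarrow> bool" where
  "quadrilinear_map sH sW f \<longleftrightarrow>
     (\<forall>b c d. Vector_Spaces.linear sH sW (\<lambda>a. f a b c d)) \<and>
     (\<forall>a c d. Vector_Spaces.linear sH sW (\<lambda>b. f a b c d)) \<and>
     (\<forall>a b d. Vector_Spaces.linear sH sW (\<lambda>c. f a b c d)) \<and>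
     (\<forall>a b c. Vector_Spaces.linear sH sW (\<lambda>d. f a b c d))"

context coalgebra
begin

lemma linear_sweedler2_parameter:
  assumes "\<And>p. bilinear_map sH sH sW (f p)"
    and "\<And>a b. Vector_Spaces.linear sP sW (\<lambda>p. f p a b)"
  shows "Vector_Spaces.linear sP sW (\<lambda>p. sweedler2 sH \<Delta> sW h (f p))"
  unfolding sweedler2_def by (rule linear_sweedler_parameter[OF comult_in assms])

lemma linear_sweedler2_argument:
  assumes "bilinear_map sH sH sW f"
  shows "Vector_Spaces.linear sH sW (\<lambda>x. sweedler2 sH \<Delta> sW x f)"
  unfolding sweedler2_def by (rule linear_sweedler_argument[OF comult_linear assms])

lemma linear_image_sweedler2:
  assumes "bilinear_map sH sH sW f" and "Vector_Spaces.linear sW sW' L"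
  shows "L (sweedler2 sH \<Delta> sW h f) = sweedler2 sH \<Delta> sW' h (\<lambda>a b. L (f a b))"
  unfolding sweedler2_def by (rule linear_image_sweedler[OF comult_in assms])

text \<open>
  A Sweedler expression with four legs is a threefold iteration of expressions with two legs, so that
  commuting it with a linear map takes bilinearity at each of the three stages.
\<close>

lemma quadrilinear_map_stages:
  assumes "quadrilinear_map sH sW f"
  shows "bilinear_map sH sH sW (\<lambda>c d. f a b c d)"
    and "bilinear_map sH sH sW (\<lambda>b y. sweedler2 sH \<Delta> sW y (\<lambda>c d. f a b c d))"
    and "bilinear_map sH sH sW
           (\<lambda>a x. sweedler2 sH \<Delta> sW x (\<lambda>b y. sweedler2 sH \<Delta> sW y (\<lambda>c d. f a b c d)))"
proof -
  have f: "\<And>b c d. Vector_Spaces.linear sH sW (\<lambda>a. f a b c d)"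
    "\<And>a c d. Vector_Spaces.linear sH sW (\<lambda>b. f a b c d)"
    "\<And>a b d. Vector_Spaces.linear sH sW (\<lambda>c. f a b c d)"
    "\<And>a b c. Vector_Spaces.linear sH sW (\<lambda>d. f a b c d)"
    using assms by (simp_all add: quadrilinear_map_def)
  show 3: "bilinear_map sH sH sW (\<lambda>c d. f a b c d)" for a b
    by (intro bilinear_mapI f)
  show 2: "bilinear_map sH sH sW (\<lambda>b y. sweedler2 sH \<Delta> sW y (\<lambda>c d. f a b c d))" for a
    by (intro bilinear_mapI linear_sweedler2_parameter linear_sweedler2_argument 3 f)
  show "bilinear_map sH sH sW
      (\<lambda>a x. sweedler2 sH \<Delta> sW x (\<lambda>b y. sweedler2 sH \<Delta> sW y (\<lambda>c d. f a b c d)))"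
    by (intro bilinear_mapI linear_sweedler2_parameter linear_sweedler2_argument 2 3 f)
qed

lemma linear_sweedler4_parameter:
  assumes "\<And>p. quadrilinear_map sH sW (f p)"
    and "\<And>a b c d. Vector_Spaces.linear sP sW (\<lambda>p. f p a b c d)"
  shows "Vector_Spaces.linear sP sW (\<lambda>p. sweedler4 sH \<Delta> sW h (f p))"
  unfolding sweedler4_def
  by (intro linear_sweedler2_parameter quadrilinear_map_stages[OF assms(1)] assms(2))

lemma linear_image_sweedler4:
  assumes f: "quadrilinear_map sH sW f" and L: "Vector_Spaces.linear sW sW' L"
  shows "L (sweedler4 sH \<Delta> sW h f) = sweedler4 sH \<Delta> sW' h (\<lambda>a b c d. L (f a b c d))"
  unfolding sweedler4_def
  by (simp add: linear_image_sweedler2[OF quadrilinear_map_stages(1)[OF f] L]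
      linear_image_sweedler2[OF quadrilinear_map_stages(2)[OF f] L]
      linear_image_sweedler2[OF quadrilinear_map_stages(3)[OF f] L])

end


section \<open>Tensoring with a line\<close>

locale line = vector_space sV
  for sV :: "'k::field \<Rightarrow> 'v::ab_group_add \<Rightarrow> 'v" +
  fixes e :: 'v
  assumes nonzero: "e \<noteq> 0" and spans: "\<exists>c. v = sV c e"
begin

definition coord :: "'v \<Rightarrow> 'k" where
  "coord v = (SOME c. v = sV c e)"

lemma scale_coord: "sV (coord v) e = v"
  unfolding coord_def using someI_ex[OF spans[of v]] by simp

lemma coord_scale: "coord (sV c e) = c"
  using scale_coord[of "sV c e"] nonzero by (simp add: scale_cancel_right)

lemma linear_coord: "Vector_Spaces.linear sV (*) coord"
proof -
  have "coord (v + w) = coord v + coord w" for v w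
    using coord_scale[of "coord v + coord w"] by (simp add: scale_left_distrib scale_coord)
  moreover have "coord (sV c v) = c * coord v" for c v
    using coord_scale[of "c * coord v"] by (simp add: scale_scale[symmetric] scale_coord del: scale_scale)
  ultimately show ?thesis
    by (simp add: Vector_Spaces.linear_iff vector_space_field vector_space_axioms)
qed

lemma coord_generator: "coord e = 1"
  using coord_scale[of 1] by simp

text \<open>
  The bilinear map \<open>(h, v) \<mapsto> coord v \<cdot> h\<close> induces an inverse of \<open>h \<mapsto> h \<otimes> e\<close>.
\<close>

lemma tensor_generator_inj:
  assumes H: "vector_space sH" and eq: "tensor sH sV x e = tensor sH sV y e"
  shows "x = y"
proof -
  have b: "bilinear_map sH sV sH (\<lambda>h v. sH (coord v) h)"
    by (intro bilinear_mapI)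
       (simp_all add: Vector_Spaces.linear_iff H vector_space_axioms linear_mapD[OF linear_coord]
          vector_space.vector_space_assms[OF H] mult.commute)
  have "tensor_lift sH sV sH (\<lambda>h v. sH (coord v) h) (tensor sH sV z e) = z" for z
    unfolding tensor_lift_tensor[OF b] coord_generator by (rule vector_space.vector_space_assms(4)[OF H])
  then show ?thesis using eq by metis
qed

text \<open>
  Sums of pure tensors collapse to a single one because \<open>a \<otimes> c e = c a \<otimes> e\<close>.
\<close>

lemma tensor_space_line:
  assumes H: "vector_space sH" and "t \<in> tensor_space sH sV"
  obtains g where "t = tensor sH sV g e"
proof -
  interpret T: vector_space fun_scale by (rule vector_space_fun_scale)
  interpret H: vector_space sH by fact
  have bil: "bilinear_map sH sV fun_scale (tensor sH sV)"
    by (rule bilinear_map_tensor[OF H vector_space_axioms])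
  have add: "tensor sH sV (x + y) v = tensor sH sV x v + tensor sH sV y v"
    and scl: "tensor sH sV (sH c x) v = fun_scale c (tensor sH sV x v)"
    and scr: "tensor sH sV x (sV c v) = fun_scale c (tensor sH sV x v)" for c x y v
    using bil by (simp_all add: bilinear_map_def Vector_Spaces.linear_iff)
  have "t \<in> T.span {tensor sH sV a b | a b. True}"
    using assms(2) by (simp add: tensor_space_def)
  then have "\<exists>g. t = tensor sH sV g e"
  proof (induction rule: T.span_induct_alt)
    case base
    have "tensor sH sV 0 e = 0"
      using scl[of 0 0 e] by simp
    then show ?case by metis
  next
    case (step c x y)
    then obtain a b g where "x = tensor sH sV a b" "y = tensor sH sV g e" by blast
    then have "fun_scale c x + y = tensor sH sV (sH c (sH (coord b) a) + g) e"
      using scr[of a "coord b" e] by (simp only: add scl scale_coord)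
    then show ?case by blast
  qed
  then show ?thesis using that by blast
qed

end

lemma (in vector_space) line_of_dim_1:
  assumes "dim UNIV = 1"
  obtains e where "line scale e"
proof -
  obtain B where B: "independent B" "UNIV \<subseteq> span B" "card B = dim UNIV"
    using basis_exists by blast
  then obtain e where e: "B = {e}" using assms card_1_singletonE by metis
  have "line scale e"
  proof
    show "e \<noteq> 0" using B(1) e by simp
    show "\<exists>c. v = scale c e" for v
      using B(2) unfolding e span_singleton by blast
  qed
  then show ?thesis by (rule that)
qed


section \<open>Coactions on a line\<close>

lemma (in line) coaction_on_line:
  assumes H: "vector_space sH" and lin: "Vector_Spaces.linear sV fun_scale \<rho>"
    and space: "\<And>v. \<rho> v \<in> tensor_space sH sV"
  obtains g where "\<And>v. \<rho> v = tensor sH sV g v"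
proof -
  obtain g where g: "\<rho> e = tensor sH sV g e"
    using tensor_space_line[OF H space] by blast
  have bil: "bilinear_map sH sV fun_scale (tensor sH sV)"
    by (rule bilinear_map_tensor[OF H vector_space_axioms])
  have "\<rho> v = tensor sH sV g v" for v
  proof -
    have "\<rho> (sV (coord v) e) = tensor sH sV g (sV (coord v) e)"
      using lin bil by (simp add: bilinear_map_def Vector_Spaces.linear_iff g)
    then show ?thesis by (simp add: scale_coord)
  qed
  then show ?thesis by (rule that)
qed

text \<open>
  Coassociativity of the coaction at \<open>e\<close> reads \<open>\<Delta> g \<otimes> e = g \<otimes> g \<otimes> e\<close>, and the counit axiom reads
  \<open>\<epsilon>(g) e = e\<close>.
\<close>

lemma (in line) grouplike_of_comodule:
  assumes com: "left_comodule sH \<Delta> \<epsilon> sV \<rho>" and \<rho>: "\<And>v. \<rho> v = tensor sH sV g v"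
  shows "g \<in> grouplike sH \<Delta> \<epsilon>"
proof -
  interpret C: left_comodule sH \<Delta> \<epsilon> sV \<rho> by fact
  have H: "vector_space sH" and V: "vector_space sV"
    by (rule C.vector_space_axioms vector_space_axioms)+
  have trilin: "trilinear_map sH sH sV fun_scale (tensor3 sH sH sV)"
    by (rule trilinear_map_tensor3[OF H H V])
  have tri2: "bilinear_map sH sH fun_scale (\<lambda>a b. tensor3 sH sH sV a b v)" for v
    using trilin by (simp add: trilinear_map_def bilinear_map_def)
  have b1: "bilinear_map sH sV fun_scale
      (\<lambda>x v. sweedler2 sH \<Delta> fun_scale x (\<lambda>a b. tensor3 sH sH sV a b v))"
    using trilin by (intro bilinear_mapI C.linear_sweedler2_argument C.linear_sweedler2_parameter tri2)
      (simp add: trilinear_map_def)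
  have b2: "bilinear_map sH sV fun_scale (\<lambda>b v. tensor3 sH sH sV a b v)" for a
    using trilin by (simp add: trilinear_map_def bilinear_map_def)
  have b3: "bilinear_map sH sV fun_scale (\<lambda>a w. tensor3 sH sH sV a g w)"
    using trilin by (simp add: trilinear_map_def bilinear_map_def)
  have coassoc: "sweedler2 sH \<Delta> fun_scale g (\<lambda>a b. tensor3 sH sH sV a b e) = tensor3 sH sH sV g g e"
    using C.coact_coassoc[of e]
    by (simp add: sweedler_pure[OF \<rho>] b1 b2 b3)
  have b: "bilinear_map sH sH fun_scale (tensor sH sH)"
    by (rule bilinear_map_tensor[OF H H])
  have t: "trilinear_map sH sH sV fun_scale (\<lambda>a b v. fun_scale (coord v) (tensor sH sH a b))"
    using b
    by (simp add: trilinear_map_def bilinear_map_def Vector_Spaces.linear_iff V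
        vector_space_fun_scale linear_mapD[OF linear_coord])
       (simp add: vector_space.vector_space_assms[OF vector_space_fun_scale] mult.commute)
  \<comment> \<open>\<open>L\<close> strips the factor \<open>e\<close>: it maps \<open>a \<otimes> b \<otimes> v\<close> to \<open>coord v \<cdot> (a \<otimes> b)\<close>.\<close>
  obtain L where L: "Vector_Spaces.linear fun_scale fun_scale L"
    "\<And>a b v. L (tensor3 sH sH sV a b v) = fun_scale (coord v) (tensor sH sH a b)"
    using tensor3_universal[OF t] by blast
  have "sweedler2 sH \<Delta> fun_scale g (tensor sH sH) = tensor sH sH g g"
    using arg_cong[OF coassoc, of L] L(2)
    by (simp add: C.linear_image_sweedler2[OF tri2 L(1)] coord_generator fun_scale_def)
  \<comment> \<open>The lift of the universal bilinear map is the identity on \<open>H \<otimes> H\<close>.\<close>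
  moreover have "tensor_lift sH sH fun_scale (tensor sH sH) (\<Delta> g) = \<Delta> g"
    using tensor_unique[OF linear_tensor_lift[OF b]
        vector_space.linear_id[OF vector_space_fun_scale] _ C.comult_in]
    by (simp add: tensor_lift_tensor[OF b])
  ultimately have \<Delta>: "\<Delta> g = tensor sH sH g g"
    by (simp add: sweedler2_def sweedler_def)
  have "bilinear_map sH sV sV (\<lambda>h v. sV (\<epsilon> h) v)"
    by (intro bilinear_mapI)
       (simp_all add: Vector_Spaces.linear_iff H V linear_mapD[OF C.counit_linear]
          scale_left_distrib scale_right_distrib mult.commute)
  then have "sV (\<epsilon> g) e = e"
    using C.coact_counit[of e] by (simp add: sweedler_pure[OF \<rho>])
  then have "\<epsilon> g = 1"
    using coord_scale[of "\<epsilon> g"] by (simp add: coord_generator)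
  with \<Delta> show ?thesis by (simp add: grouplike_def)
qed


section \<open>Yetter-Drinfeld axioms for an action by scalars\<close>

locale line_with_action =
  dual_quasi_bialgebra sH \<Delta> \<epsilon> m u \<omega> + V: line sV e
  for sH :: "'k::field \<Rightarrow> 'h::ab_group_add \<Rightarrow> 'h" and \<Delta> \<epsilon> m u \<omega>
    and sV :: "'k \<Rightarrow> 'v::ab_group_add \<Rightarrow> 'v" and e +
  fixes \<rho> :: "'v \<Rightarrow> (('h \<Rightarrow> 'v \<Rightarrow> 'k) \<Rightarrow> 'k)" and act :: "'h \<Rightarrow> 'v \<Rightarrow> 'v"
    and g :: 'h and \<chi> :: "'h \<Rightarrow> 'k"
  assumes coaction: "\<rho> v = tensor sH sV g v"
    and action: "act h v = sV (\<chi> h) v"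
    and \<chi>_linear: "Vector_Spaces.linear sH (*) \<chi>"
begin

abbreviation \<omega>' :: "'h \<Rightarrow> 'h \<Rightarrow> 'h \<Rightarrow> 'k" where
  "\<omega>' \<equiv> conv_inverse3 sH \<Delta> \<epsilon> \<omega>"

lemma inverse_reassociator_trilinear: "trilinear_map sH sH sH (*) \<omega>'"
  using someI_ex[OF reassociator_invertible]
  by (simp add: conv_inverse3_def is_conv_inverse3_def)

lemma structure_map_simps:
  "\<omega> (x + x') y z = \<omega> x y z + \<omega> x' y z" "\<omega> (sH c x) y z = c * \<omega> x y z"
  "\<omega> x (y + y') z = \<omega> x y z + \<omega> x y' z" "\<omega> x (sH c y) z = c * \<omega> x y z"
  "\<omega> x y (z + z') = \<omega> x y z + \<omega> x y z'" "\<omega> x y (sH c z) = c * \<omega> x y z"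
  "\<omega>' (x + x') y z = \<omega>' x y z + \<omega>' x' y z" "\<omega>' (sH c x) y z = c * \<omega>' x y z"
  "\<omega>' x (y + y') z = \<omega>' x y z + \<omega>' x y' z" "\<omega>' x (sH c y) z = c * \<omega>' x y z"
  "\<omega>' x y (z + z') = \<omega>' x y z + \<omega>' x y z'" "\<omega>' x y (sH c z) = c * \<omega>' x y z"
  "\<chi> (x + x') = \<chi> x + \<chi> x'" "\<chi> (sH c x) = c * \<chi> x"
  "m (x + x') y = m x y + m x' y" "m (sH c x) y = sH c (m x y)"
  "m x (y + y') = m x y + m x y'" "m x (sH c y) = sH c (m x y)"
  using reassociator_trilinear inverse_reassociator_trilinear \<chi>_linear mult_bilinear
  by (simp_all add: trilinear_map_def bilinear_map_def Vector_Spaces.linear_iff)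

text \<open>
  The scalar by which the composite of the two actions and three reassociators multiplies \<open>v\<close>. The
  argument order makes it a four-legged integrand in \<open>l\<close> for fixed legs of \<open>h\<close>.
\<close>

definition twist :: "'h \<Rightarrow> 'h \<Rightarrow> 'h \<Rightarrow> 'h \<Rightarrow> 'h \<Rightarrow> 'h \<Rightarrow> 'h \<Rightarrow> 'h \<Rightarrow> 'k" where
  "twist h\<^sub>1 h\<^sub>2 h\<^sub>3 h\<^sub>4 l\<^sub>1 l\<^sub>2 l\<^sub>3 l\<^sub>4 =
     \<omega>' h\<^sub>1 l\<^sub>1 g * \<chi> l\<^sub>2 * \<omega> h\<^sub>2 g l\<^sub>3 * \<chi> h\<^sub>3 * \<omega>' g h\<^sub>4 l\<^sub>4"

lemma linear_into_field_iff:
  "Vector_Spaces.linear sH (*) f \<longleftrightarrow>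
     (\<forall>x y. f (x + y) = f x + f y) \<and> (\<forall>c x. f (sH c x) = c * f x)"
  by (simp add: Vector_Spaces.linear_iff vector_space_axioms vector_space_field)

lemma twist_quadrilinear_inner: "quadrilinear_map sH (*) (twist h\<^sub>1 h\<^sub>2 h\<^sub>3 h\<^sub>4)"
  by (simp add: quadrilinear_map_def linear_into_field_iff twist_def structure_map_simps
      algebra_simps)

lemma twist_quadrilinear_outer:
  "quadrilinear_map sH (*) (\<lambda>h\<^sub>1 h\<^sub>2 h\<^sub>3 h\<^sub>4. sweedler4 sH \<Delta> (*) l (twist h\<^sub>1 h\<^sub>2 h\<^sub>3 h\<^sub>4))"
  unfolding quadrilinear_map_def
  by (intro conjI allI linear_sweedler4_parameter twist_quadrilinear_inner)
     (simp_all add: linear_into_field_iff twist_def structure_map_simps algebra_simps)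

lemma linear_scale_vector: "Vector_Spaces.linear (*) sV (\<lambda>c. sV c v)"
  by (simp add: Vector_Spaces.linear_iff vector_space_field V.vector_space_axioms V.scale_left_distrib)

text \<open>
  Since \<open>\<rho> z = g \<otimes> z\<close> for every \<open>z\<close>, each coaction only inserts \<open>g\<close> into a reassociator; the vector
  itself is merely rescaled by \<open>\<chi>\<close>.
\<close>

lemma sweedler_action_rule:
  "sweedler sH sV sV \<rho> v (\<lambda>v' v\<^sub>0.
     sweedler sH sV sV \<rho> (act l\<^sub>2 v\<^sub>0) (\<lambda>a w.
     sweedler sH sV sV \<rho> (act h\<^sub>3 w) (\<lambda>b x.
       sV (\<omega>' h\<^sub>1 l\<^sub>1 v' * \<omega> h\<^sub>2 a l\<^sub>3 * \<omega>' b h\<^sub>4 l\<^sub>4) x))) =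
   sV (twist h\<^sub>1 h\<^sub>2 h\<^sub>3 h\<^sub>4 l\<^sub>1 l\<^sub>2 l\<^sub>3 l\<^sub>4) v"
proof -
  have pure: "sweedler sH sV sV \<rho> z (\<lambda>a w. sV (\<phi> a) w) = sV (\<phi> g) z"
    if "Vector_Spaces.linear sH (*) \<phi>" for \<phi> z
    by (intro sweedler_pure coaction bilinear_mapI)
       (simp_all add: Vector_Spaces.linear_iff vector_space_axioms V.vector_space_axioms
          linear_mapD[OF that] V.scale_left_distrib V.scale_right_distrib mult.commute)
  show ?thesis
    by (simp add: action pure linear_into_field_iff structure_map_simps algebra_simps twist_def)
qed

lemma sweedler_act_mult:
  "sweedler4 sH \<Delta> sV h (\<lambda>h\<^sub>1 h\<^sub>2 h\<^sub>3 h\<^sub>4. sweedler4 sH \<Delta> sV l (\<lambda>l\<^sub>1 l\<^sub>2 l\<^sub>3 l\<^sub>4.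
     sV (twist h\<^sub>1 h\<^sub>2 h\<^sub>3 h\<^sub>4 l\<^sub>1 l\<^sub>2 l\<^sub>3 l\<^sub>4) v)) =
   sV (sweedler4 sH \<Delta> (*) h (\<lambda>h\<^sub>1 h\<^sub>2 h\<^sub>3 h\<^sub>4. sweedler4 sH \<Delta> (*) l (twist h\<^sub>1 h\<^sub>2 h\<^sub>3 h\<^sub>4))) v"
  by (simp add: linear_image_sweedler4[OF twist_quadrilinear_outer linear_scale_vector]
      linear_image_sweedler4[OF twist_quadrilinear_inner linear_scale_vector])

lemma act_mult_iff:
  "(\<forall>h l v. act (m h l) v =
         sweedler4 sH \<Delta> sV h (\<lambda>h\<^sub>1 h\<^sub>2 h\<^sub>3 h\<^sub>4. sweedler4 sH \<Delta> sV l (\<lambda>l\<^sub>1 l\<^sub>2 l\<^sub>3 l\<^sub>4.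
           sweedler sH sV sV \<rho> v (\<lambda>v' v\<^sub>0.
           sweedler sH sV sV \<rho> (act l\<^sub>2 v\<^sub>0) (\<lambda>a w.
           sweedler sH sV sV \<rho> (act h\<^sub>3 w) (\<lambda>b x.
             sV (\<omega>' h\<^sub>1 l\<^sub>1 v' * \<omega> h\<^sub>2 a l\<^sub>3 * \<omega>' b h\<^sub>4 l\<^sub>4) x)))))) \<longleftrightarrow>
   (\<forall>h l. \<chi> (m h l) =
          sweedler4 sH \<Delta> (*) h (\<lambda>h\<^sub>1 h\<^sub>2 h\<^sub>3 h\<^sub>4. sweedler4 sH \<Delta> (*) l (\<lambda>l\<^sub>1 l\<^sub>2 l\<^sub>3 l\<^sub>4.
            \<omega>' h\<^sub>1 l\<^sub>1 g * \<chi> l\<^sub>2 * \<omega> h\<^sub>2 g l\<^sub>3 * \<chi> h\<^sub>3 * \<omega>' g h\<^sub>4 l\<^sub>4)))"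
  unfolding sweedler_action_rule sweedler_act_mult unfolding action twist_def
  using V.nonzero by (auto simp: V.scale_cancel_right)

lemma act_unit_iff: "(\<forall>v. act (u 1) v = v) \<longleftrightarrow> \<chi> (u 1) = 1"
proof
  assume "\<forall>v. act (u 1) v = v"
  then have "V.coord (sV (\<chi> (u 1)) e) = V.coord e" by (simp add: action)
  then show "\<chi> (u 1) = 1" by (simp add: V.coord_scale V.coord_generator)
qed (simp add: action)

text \<open>
  The two sides of the compatibility axiom are \<open>x \<otimes> v\<close> and \<open>y \<otimes> v\<close>, where \<open>x\<close> and \<open>y\<close> are the
  two sides of the identity in \<open>H\<close>; for \<open>v = e\<close> the second factor can be cancelled.
\<close>

lemma act_coact_iff:
  "(\<forall>h v. sweedler2 sH \<Delta> fun_scale h (\<lambda>h\<^sub>1 h\<^sub>2. sweedler sH sV fun_scale \<rho> (act h\<^sub>1 v) (\<lambda>a w.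
         tensor sH sV (m a h\<^sub>2) w)) =
       sweedler2 sH \<Delta> fun_scale h (\<lambda>h\<^sub>1 h\<^sub>2. sweedler sH sV fun_scale \<rho> v (\<lambda>v' v\<^sub>0.
         tensor sH sV (m h\<^sub>1 v') (act h\<^sub>2 v\<^sub>0)))) \<longleftrightarrow>
   (\<forall>h. sweedler2 sH \<Delta> sH h (\<lambda>h\<^sub>1 h\<^sub>2. m g (sH (\<chi> h\<^sub>1) h\<^sub>2)) =
        sweedler2 sH \<Delta> sH h (\<lambda>h\<^sub>1 h\<^sub>2. m (sH (\<chi> h\<^sub>2) h\<^sub>1) g))"
    (is "(\<forall>h v. ?lhs h v = ?rhs h v) \<longleftrightarrow> (\<forall>h. ?x h = ?y h)")
proof -
  have H: "vector_space sH" and V: "vector_space sV"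
    by (rule vector_space_axioms V.vector_space_axioms)+
  have bil: "bilinear_map sH sV fun_scale (tensor sH sV)"
    by (rule bilinear_map_tensor[OF H V])
  have tensor_simps: "tensor sH sV (x + y) v = tensor sH sV x v + tensor sH sV y v"
    "tensor sH sV (sH c x) v = fun_scale c (tensor sH sV x v)"
    "tensor sH sV x (v + w) = tensor sH sV x v + tensor sH sV x w"
    "tensor sH sV x (sV c v) = fun_scale c (tensor sH sV x v)" for c x y v w
    using bil by (simp_all add: bilinear_map_def Vector_Spaces.linear_iff)
  have L: "Vector_Spaces.linear sH fun_scale (\<lambda>x. tensor sH sV x v)" for v
    using bil by (simp add: bilinear_map_def)
  note fs = vector_space.vector_space_assms[OF vector_space_fun_scale]
  have left_bil: "bilinear_map sH sH sH (\<lambda>h\<^sub>1 h\<^sub>2. m g (sH (\<chi> h\<^sub>1) h\<^sub>2))"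
    by (intro bilinear_mapI)
       (simp_all add: Vector_Spaces.linear_iff H structure_map_simps scale_left_distrib
          scale_right_distrib mult.commute)
  have right_bil: "bilinear_map sH sH sH (\<lambda>h\<^sub>1 h\<^sub>2. m (sH (\<chi> h\<^sub>2) h\<^sub>1) g)"
    by (intro bilinear_mapI)
       (simp_all add: Vector_Spaces.linear_iff H structure_map_simps scale_left_distrib
          scale_right_distrib mult.commute)
  have "bilinear_map sH sV fun_scale (\<lambda>a w. tensor sH sV (m a k) w)" for k
    by (intro bilinear_mapI)
       (simp_all add: Vector_Spaces.linear_iff H V vector_space_fun_scale structure_map_simps
          tensor_simps)
  then have left: "?lhs h v = tensor sH sV (?x h) v" for h v
    unfolding linear_image_sweedler2[OF left_bil L]
    by (simp add: sweedler_pure[OF coaction] action structure_map_simps tensor_simps)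
  have "bilinear_map sH sV fun_scale (\<lambda>a w. tensor sH sV (m k a) (act l w))" for k l
    by (intro bilinear_mapI)
       (simp_all add: Vector_Spaces.linear_iff H V vector_space_fun_scale structure_map_simps
          tensor_simps action V.scale_right_distrib fs mult.commute)
  then have right: "?rhs h v = tensor sH sV (?y h) v" for h v
    unfolding linear_image_sweedler2[OF right_bil L]
    by (simp add: sweedler_pure[OF coaction] action structure_map_simps tensor_simps)
  show ?thesis
    unfolding left right using V.tensor_generator_inj[OF H] by metis
qed

lemma yetter_drinfeld_module_iff:
  assumes act: "bilinear_map sH sV sV act"
  shows "yetter_drinfeld_module sH \<Delta> \<epsilon> m u \<omega> sV \<rho> act \<longleftrightarrow>
    left_comodule sH \<Delta> \<epsilon> sV \<rho> \<and> \<chi> (u 1) = 1 \<and>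
    (\<forall>h l. \<chi> (m h l) =
       sweedler4 sH \<Delta> (*) h (\<lambda>h\<^sub>1 h\<^sub>2 h\<^sub>3 h\<^sub>4. sweedler4 sH \<Delta> (*) l (\<lambda>l\<^sub>1 l\<^sub>2 l\<^sub>3 l\<^sub>4.
         \<omega>' h\<^sub>1 l\<^sub>1 g * \<chi> l\<^sub>2 * \<omega> h\<^sub>2 g l\<^sub>3 * \<chi> h\<^sub>3 * \<omega>' g h\<^sub>4 l\<^sub>4))) \<and>
    (\<forall>h. sweedler2 sH \<Delta> sH h (\<lambda>h\<^sub>1 h\<^sub>2. m g (sH (\<chi> h\<^sub>1) h\<^sub>2)) =
         sweedler2 sH \<Delta> sH h (\<lambda>h\<^sub>1 h\<^sub>2. m (sH (\<chi> h\<^sub>2) h\<^sub>1) g))"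
  unfolding yetter_drinfeld_module_def yetter_drinfeld_module_axioms_def
    act_mult_iff[symmetric] act_unit_iff[symmetric] act_coact_iff[symmetric]
  using act dual_quasi_bialgebra_axioms by auto

end


section \<open>One-dimensional Yetter-Drinfeld modules\<close>

theorem proposition3p9:
  fixes sH :: "'k::{alg_closed_field, field_char_0} \<Rightarrow> 'h::ab_group_add \<Rightarrow> 'h"
    and \<Delta> :: "'h \<Rightarrow> (('h \<Rightarrow> 'h \<Rightarrow> 'k) \<Rightarrow> 'k)"
    and \<epsilon> :: "'h \<Rightarrow> 'k"
    and m :: "'h \<Rightarrow> 'h \<Rightarrow> 'h"
    and u :: "'k \<Rightarrow> 'h"
    and \<omega> :: "'h \<Rightarrow> 'h \<Rightarrow> 'h \<Rightarrow> 'k"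
    and sV :: "'k \<Rightarrow> 'v::ab_group_add \<Rightarrow> 'v"
    and \<rho> :: "'v \<Rightarrow> (('h \<Rightarrow> 'v \<Rightarrow> 'k) \<Rightarrow> 'k)"
    and act :: "'h \<Rightarrow> 'v \<Rightarrow> 'v"
  assumes "dual_quasi_bialgebra sH \<Delta> \<epsilon> m u \<omega>"
    and "vector_space sV" and "vector_space.dim sV UNIV = 1"
    and "Vector_Spaces.linear sV fun_scale \<rho>" and "\<And>v. \<rho> v \<in> tensor_space sH sV"
    and "bilinear_map sH sV sV act"
  shows "yetter_drinfeld_module sH \<Delta> \<epsilon> m u \<omega> sV \<rho> act \<longleftrightarrow>
    (\<exists>g \<chi>. g \<in> grouplike sH \<Delta> \<epsilon> \<and> Vector_Spaces.linear sH (*) \<chi> \<and> \<chi> (u 1) = 1 \<and>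
      (left_comodule sH \<Delta> \<epsilon> sV \<rho> \<and> (\<forall>v. \<rho> v = tensor sH sV g v)) \<and>
      ((\<forall>h v. act h v = sV (\<chi> h) v) \<and>
       (\<forall>h l. \<chi> (m h l) =
          sweedler4 sH \<Delta> (*) h (\<lambda>h\<^sub>1 h\<^sub>2 h\<^sub>3 h\<^sub>4. sweedler4 sH \<Delta> (*) l (\<lambda>l\<^sub>1 l\<^sub>2 l\<^sub>3 l\<^sub>4.
            conv_inverse3 sH \<Delta> \<epsilon> \<omega> h\<^sub>1 l\<^sub>1 g * \<chi> l\<^sub>2 * \<omega> h\<^sub>2 g l\<^sub>3 * \<chi> h\<^sub>3 *
            conv_inverse3 sH \<Delta> \<epsilon> \<omega> g h\<^sub>4 l\<^sub>4)))) \<and>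
      (\<forall>h. sweedler2 sH \<Delta> sH h (\<lambda>h\<^sub>1 h\<^sub>2. m g (sH (\<chi> h\<^sub>1) h\<^sub>2)) =
           sweedler2 sH \<Delta> sH h (\<lambda>h\<^sub>1 h\<^sub>2. m (sH (\<chi> h\<^sub>2) h\<^sub>1) g)))"
    (is "_ \<longleftrightarrow> (\<exists>g \<chi>. ?D g \<chi>)")
proof -
  interpret D: dual_quasi_bialgebra sH \<Delta> \<epsilon> m u \<omega> by fact
  obtain e where e: "line sV e"
    using vector_space.line_of_dim_1[OF assms(2,3)] by blast
  interpret V: line sV e by fact
  have rank_one: "line_with_action sH \<Delta> \<epsilon> m u \<omega> sV e \<rho> act g \<chi>"
    if "\<forall>v. \<rho> v = tensor sH sV g v" "\<forall>h v. act h v = sV (\<chi> h) v" "Vector_Spaces.linear sH (*) \<chi>"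
    for g \<chi>
    using that assms(1) e by (simp add: line_with_action_def line_with_action_axioms_def)
  show ?thesis
  proof
    assume Y: "yetter_drinfeld_module sH \<Delta> \<epsilon> m u \<omega> sV \<rho> act"
    then have com: "left_comodule sH \<Delta> \<epsilon> sV \<rho>"
      by (rule yetter_drinfeld_module.axioms)
    obtain g where g: "\<And>v. \<rho> v = tensor sH sV g v"
      using V.coaction_on_line[OF D.vector_space_axioms assms(4,5)] by blast
    define \<chi> where "\<chi> h = V.coord (act h e)" for h
    have \<chi>: "Vector_Spaces.linear sH (*) \<chi>"
      using assms(6) V.linear_coord by (simp add: \<chi>_def bilinear_map_def Vector_Spaces.linear_iff)
    have act: "act h v = sV (\<chi> h) v" for h v
    proof -
      have "act h (sV (V.coord v) e) = sV (V.coord v) (act h e)"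
        using assms(6) by (simp add: bilinear_map_def Vector_Spaces.linear_iff)
      also have "\<dots> = sV (V.coord v) (sV (\<chi> h) e)"
        by (simp add: \<chi>_def V.scale_coord)
      also have "\<dots> = sV (\<chi> h) (sV (V.coord v) e)"
        by (rule V.scale_left_commute)
      finally show ?thesis by (simp add: V.scale_coord)
    qed
    interpret line_with_action sH \<Delta> \<epsilon> m u \<omega> sV e \<rho> act g \<chi>
      using g act \<chi> by (intro rank_one) auto
    have "g \<in> grouplike sH \<Delta> \<epsilon>"
      using V.grouplike_of_comodule[OF com g] .
    with Y g act \<chi> show "\<exists>g \<chi>. ?D g \<chi>"
      unfolding yetter_drinfeld_module_iff[OF assms(6)] by blast
  next
    assume "\<exists>g \<chi>. ?D g \<chi>"
    then obtain g \<chi> where D: "?D g \<chi>" by blast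
    then interpret line_with_action sH \<Delta> \<epsilon> m u \<omega> sV e \<rho> act g \<chi>
      by (intro rank_one) auto
    show "yetter_drinfeld_module sH \<Delta> \<epsilon> m u \<omega> sV \<rho> act"
      unfolding yetter_drinfeld_module_iff[OF assms(6)] using D by blast
  qed
qed

end
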